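(* Let $C=\prod_{j\ge1}(1+2^{1-2^{j-1}})\approx3.40147$. With $n_H=\lceil n/2\rceil$, $n_L=\lfloor n/2\rfloor$, the routing-added CNOT gate count $S^{\mathrm{GPF}\text{-}2\mathrm L}_{\mathrm{route}}(n)$ of the complete $\mathrm{GPF}(n)$ compiled on the $2\times n_H$ nearest-neighbor grid satisfies the recurrences $$\begin{aligned} S^{\mathrm{GPF}\text{-}2\mathrm L}_{\mathrm{route}}(n)&=3(n_H-1)\mu_{\mathrm{jump}}2^{n_H}D^{\mathrm{GPF}^*}_z(n_L)+S^{\mathrm{GPF}\text{-}1\mathrm L}_{\mathrm{route}}(n_H,0)+S^{\mathrm{GPF}^*\text{-}1\mathrm L}_{\mathrm{route}}(n_L,0),\\ S^{\mathrm{GPF}\text{-}1\mathrm L}_{\mathrm{route}}(n,r)&=3(2n_H-1)\mu_{\mathrm{jump}}2^{r}2^{n_H}D^{\mathrm{GPF}^*}_z(n_L)+S^{\mathrm{GPF}\text{-}1\mathrm L}_{\mathrm{route}}(n_H,r+1)+S^{\mathrm{GPF}^*\text{-}1\mathrm L}_{\mathrm{route}}(n_L,r+1),\\ S^{\mathrm{GPF}^*\text{-}1\mathrm L}_{\mathrm{route}}(n,r)&=3(2n_H-1)\mu_{\mathrm{jump}}2^{r}2^{n_H}D^{\mathrm{GPF}^*}_z(n_L)+S^{\mathrm{GPF}^*\text{-}1\mathrm L}_{\mathrm{route}}(n_H,r+1)+S^{\mathrm{GPF}^*\text{-}1\mathrm L}_{\mathrm{route}}(n_L,r+1), \end{aligned}$$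 where all three quantities are $0$ for $n\le2$. The normalized gate count $S^{\mathrm{GPF}\text{-}2\mathrm L}_{\mathrm{route}}(n)/2^n$ oscillates in sawtooth fashion, with subsequence limits as $\lambda\to\infty$ ($n$ the argument of the count function) $$\frac{S^{\mathrm{GPF}\text{-}2\mathrm L}_{\mathrm{route}}(2^\lambda)}{2^n}\to\tfrac32\mu_{\mathrm{jump}}C\approx5.41,\qquad \frac{S^{\mathrm{GPF}\text{-}2\mathrm L}_{\mathrm{route}}(2^\lambda-1)}{2^n}\to\tfrac32\mu_{\mathrm{jump}}\cdot2(C-1)\approx7.64,$$ the numerical values being for $\mu_{\mathrm{jump}}\approx1.06$.
   Context: $D^{\mathrm{GPF}^*}_z$ is defined by $D^{\mathrm{GPF}^*}_z(1)=1$ and $D^{\mathrm{GPF}^*}_z(n)=2^{n_H-1}D^{\mathrm{GPF}^*}_z(n_L)+D^{\mathrm{GPF}^*}_z(n_H)$ for $n\ge2$. Setting. $\mathrm{GPF}(n)$ is a recursive ancilla-free circuit family over CNOT and phase gates for $n$-qubit diagonal unitaries. The qubits are split into $n_H$ high qubits and $n_L$ low qubits. $\mathrm{GPF}(n)$ consists of (i) $D^{\mathrm{GPF}^*}_z(n_L)$ top-level mixing blocks GPS between the two halves, (ii) a recursive $\mathrm{GPF}(n_H)$ on the high qubits, and (iii) a recursive $\mathrm{GPF}^*(n_L)$ on the low qubits; $\mathrm{GPF}^*(n)$ likewise consists of $D^{\mathrm{GPF}^*}_z(n_L)$ mixing blocks $\mathrm{GPS}^*$ and recursive $\mathrm{GPF}^*(n_H)$,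 $\mathrm{GPF}^*(n_L)$. A GPS block of high width $w$ executes, for $t=0,\dots,2^w-1$, a parallel layer of CNOTs with control high qubit $(f_t+j)\bmod w$ and target low qubit $j$, where $G=(f_0,\dots,f_{2^w-1})$ is a closed Gray-code transition sequence on $w$ coordinates (successively flipping the listed coordinates visits every element of $\mathbb F_2^w$ once and returns to $0$); $\mathrm{GPS}^*$ is a forward–reverse variant with the same routing geometry. Jump density: $\mu_{\mathrm{jump}}(G)=2^{-w}\sum_{t}\mathrm{Dist}_w(f_t,f_{(t+1)\bmod 2^w})$ with $\mathrm{Dist}_w(a,b)=\min(|a-b|,w-|a-b|)$. It is written as a single constant $\mu_{\mathrm{jump}}$ for all blocks. Compilation. Only nearest-neighbor two-qubit gates are allowed; a SWAP counts as 3 CNOTs. The two halves of the top level are placed on the two rows of a $2\times n_H$ grid; all deeper blocks are routed on single-row segments. Routing-added CNOT count counts only CNOTs introduced by routing. A top-level two-row GPS block costs $3(n_H-1)\mu_{\mathrm{jump}}2^{n_H}$ routing CNOTs; a single-row GPS or $\mathrm{GPS}^*$ block of high width $w$ at single-row recursion level $r$ costs $3(2w-1)\mu_{\mathrm{jump}}2^r2^{w}$ routing CNOTs; $O(1)$ boundary corrections per block are disregarded. $S^{\mathrm{GPF}\text{-}1\mathrm L}_{\mathrm{route}}(n,r)$ and $S^{\mathrm{GPF}^*\text{-}1\mathrm L}_{\mathrm{route}}(n,r)$ denote the routing-added CNOT counts of $\mathrm{GPF}(n)$ and $\mathrm{GPF}^*(n)$ on a single row at recursion level $r$; $S^{\mathrm{GPF}\text{-}2\mathrm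 L}_{\mathrm{route}}(n)$ is that of the complete circuit with two-row top level. *)

theory Defs
  imports "HOL-Analysis.Infinite_Products"
begin

definition hi :: "nat \<Rightarrow> nat" where
  "hi n = (n + 1) div 2"

definition lo :: "nat \<Rightarrow> nat" where
  "lo n = n div 2"

declare hi_def [termination_simp] lo_def [termination_simp]

(* Only arguments n \<ge> 1 matter; the value at 0 is a dummy. *)
fun Dz :: "nat \<Rightarrow> nat" where
  "Dz n = (if n \<le> 1 then n else 2 ^ (hi n - 1) * Dz (lo n) + Dz (hi n))"

declare Dz.simps [simp del]

(* A vector in F_2^w is represented by its support, a subset of {..<w}. *)
definition gray_state :: "nat list \<Rightarrow> nat \<Rightarrow> nat set" where
  "gray_state G t = {i. odd (card {s. s < t \<and> G ! s = i})}"

definition closed_gray_code :: "nat \<Rightarrow> nat list \<Rightarrow> bool" where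
  "closed_gray_code w G \<longleftrightarrow>
     length G = 2 ^ w \<and> set G \<subseteq> {..<w} \<and>
     bij_betw (gray_state G) {..<2 ^ w} (Pow {..<w}) \<and>
     gray_state G (2 ^ w) = {}"

definition cyc_dist :: "nat \<Rightarrow> nat \<Rightarrow> nat \<Rightarrow> int" where
  "cyc_dist w a b = min \<bar>int a - int b\<bar> (int w - \<bar>int a - int b\<bar>)"

definition jump_density :: "nat \<Rightarrow> nat list \<Rightarrow> real" where
  "jump_density w G = (\<Sum>t<2 ^ w. real_of_int (cyc_dist w (G ! t) (G ! ((t + 1) mod 2 ^ w)))) / 2 ^ w"

datatype kind = GPS | GPS_star

datatype block = Block (kind_of: kind) (high_width: nat) (low_width: nat) (transitions: "nat list")

(* The recursive block structure: mixing blocks between the two halves, then the subcircuit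
   on the high qubits, then the subcircuit on the low qubits.  Single-qubit phase gates need no
   routing and are not recorded, so circuits on at most one qubit are Local. *)
datatype circuit = Local | Split "block list" circuit circuit

(* G w is the transition sequence used by blocks of high width w. *)
fun gpf_star :: "(nat \<Rightarrow> nat list) \<Rightarrow> nat \<Rightarrow> circuit" where
  "gpf_star G n =
     (if n \<le> 1 then Local
      else Split
        (replicate (Dz (lo n)) (Block GPS_star (hi n) (lo n) (G (hi n))))
        (gpf_star G (hi n)) (gpf_star G (lo n)))"

fun gpf :: "(nat \<Rightarrow> nat list) \<Rightarrow> nat \<Rightarrow> circuit" where
  "gpf G n =
     (if n \<le> 1 then Local
      else Split
        (replicate (Dz (lo n)) (Block GPS (hi n) (lo n) (G (hi n))))
        (gpf G (hi n)) (gpf_star G (lo n)))"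

declare gpf_star.simps [simp del] gpf.simps [simp del]

(* The cost model charges every block one and the same density mu in place of the jump density of
   its own transition sequence.  The exception is high width 1: there the only transition sequence
   is [0, 0], which has no jumps at all, and its true density (zero) is charged.  Without this
   exception two adjacent qubits would incur a routing cost.  Literal equality of the densities of
   all widths cannot be demanded: at widths 2 and 3 every closed Gray code has density 1. *)
definition block_density :: "real \<Rightarrow> block \<Rightarrow> real" where
  "block_density \<mu> b =
     (if high_width b = 1 then jump_density (high_width b) (transitions b) else \<mu>)"

(* Per unit of cyclic jump distance, routing costs w - 1 SWAPs on two rows and
   (2 w - 1) * 2 ^ r SWAPs on a single row at recursion level r; a SWAP is 3 CNOTs. *)
definition two_row_block_cost :: "real \<Rightarrow> block \<Rightarrow> real" where
  "two_row_block_cost \<mu> b =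
     3 * (real (high_width b) - 1) * block_density \<mu> b * 2 ^ high_width b"

definition row_block_cost :: "real \<Rightarrow> nat \<Rightarrow> block \<Rightarrow> real" where
  "row_block_cost \<mu> r b =
     3 * (2 * real (high_width b) - 1) * block_density \<mu> b * 2 ^ r * 2 ^ high_width b"

fun row_route :: "real \<Rightarrow> nat \<Rightarrow> circuit \<Rightarrow> real" where
  "row_route \<mu> r Local = 0"
| "row_route \<mu> r (Split bs h l) =
     (\<Sum>b\<leftarrow>bs. row_block_cost \<mu> r b) + row_route \<mu> (r + 1) h + row_route \<mu> (r + 1) l"

fun two_row_route :: "real \<Rightarrow> circuit \<Rightarrow> real" where
  "two_row_route \<mu> Local = 0"
| "two_row_route \<mu> (Split bs h l) =
     (\<Sum>b\<leftarrow>bs. two_row_block_cost \<mu> b) + row_route \<mu> 0 h + row_route \<mu> 0 l"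

definition S_GPF_2L :: "real \<Rightarrow> (nat \<Rightarrow> nat list) \<Rightarrow> nat \<Rightarrow> real" where
  "S_GPF_2L \<mu> G n = two_row_route \<mu> (gpf G n)"

definition S_GPF_1L :: "real \<Rightarrow> (nat \<Rightarrow> nat list) \<Rightarrow> nat \<Rightarrow> nat \<Rightarrow> real" where
  "S_GPF_1L \<mu> G n r = row_route \<mu> r (gpf G n)"

definition S_GPF_star_1L :: "real \<Rightarrow> (nat \<Rightarrow> nat list) \<Rightarrow> nat \<Rightarrow> nat \<Rightarrow> real" where
  "S_GPF_star_1L \<mu> G n r = row_route \<mu> r (gpf_star G n)"

(* Indices are shifted by one: the factor with index j here is the factor j + 1 of the
   product over j \<ge> 1 of 1 + 2 powr (1 - 2 ^ (j - 1)). *)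
definition C_factor :: "nat \<Rightarrow> real" where
  "C_factor j = 1 + 2 powr (1 - 2 ^ j)"

definition C_const :: real where
  "C_const = (\<Prod>j. C_factor j)"

(* A bounded sequence whose teeth are the windows {2 ^ k .. 2 ^ (k + 1) - 1}: over each late window
   it climbs from below a level p to above a strictly larger level q, and the single step to
   the next power of two takes it back below p.  Monotonicity inside a window is not required
   (the teeth carry smaller teeth). *)
definition sawtooth_oscillation :: "(nat \<Rightarrow> real) \<Rightarrow> bool" where
  "sawtooth_oscillation a \<longleftrightarrow>
     Bseq a \<and>
     (\<exists>p q. p < q \<and> (\<forall>\<^sub>F k in sequentially. a (2 ^ k) \<le> p \<and> q \<le> a (2 ^ (k + 1) - 1)))"

end

theory Submission
  imports Defs
begin

text \<open>
  On top-level halves $m = 2^k$ and $m$ (respectively $m$ and $m - 1$) the recursion for $D_z$ is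
  solved exactly: $D_z(2^k) = 2^{2^k-1-k} P_k$ with $P_k$ the partial products of $C$, while
  $D_z(2^k) - D_z(2^k-1)$ obeys the same recursion without the additive term and equals
  $2^{2^k-1-k}$.  The top-level blocks therefore contribute the two claimed limits.  Everything
  routed on single rows is negligible: $D_z(n) = O(2^n/n)$ makes the cost of a width-$n$ row
  $O(2^n)$, and the two rows have only half of the qubits each.
\<close>

section \<open>The constant $C$\<close>

definition C_partial :: "nat \<Rightarrow> real" where
  "C_partial k = (\<Prod>i<k. C_factor i)"

lemma C_partial_0 [simp]: "C_partial 0 = 1"
  and C_partial_Suc [simp]: "C_partial (Suc k) = C_partial k * C_factor k"
  by (simp_all add: C_partial_def)

lemma C_factor_eq: "C_factor j = 1 + 2 / 2 ^ 2 ^ j"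
proof -
  have "(2::real) powr (2 ^ j) = 2 ^ 2 ^ j"
    using powr_realpow[of 2 "2 ^ j"] by simp
  then show ?thesis by (simp add: C_factor_def powr_diff)
qed

lemma C_factor_ge_1: "1 \<le> C_factor j"
  by (simp add: C_factor_eq)

lemma C_partial_pos: "0 < C_partial k"
  unfolding C_partial_def
  by (intro prod_pos ballI) (use C_factor_ge_1 in \<open>auto intro: less_le_trans[OF zero_less_one]\<close>)

lemma C_partial_mono: "k \<le> k' \<Longrightarrow> C_partial k \<le> C_partial k'"
proof (induction rule: dec_induct)
  case (step m)
  then show ?case
    using mult_left_mono[OF C_factor_ge_1[of m] less_imp_le[OF C_partial_pos[of m]]] by simp
qed simp

text \<open>This bounds \<open>C_factor j - 1\<close> by (1/2)^j, so a geometric series gives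
  convergence of the product.\<close>

lemma two_power_two_power_ge: "(2::real) * 2 ^ j \<le> 2 ^ 2 ^ j"
proof -
  have "Suc j \<le> 2 ^ j" by (simp add: Suc_le_eq)
  then have "(2::real) ^ Suc j \<le> 2 ^ 2 ^ j" by (intro power_increasing) auto
  then show ?thesis by simp
qed

lemma convergent_prod_C_factor: "convergent_prod C_factor"
proof -
  have "summable (\<lambda>j. norm (C_factor j - 1))"
  proof (rule summable_comparison_test')
    show "summable (\<lambda>j. (1 / 2 :: real) ^ j)" by (simp add: summable_geometric)
    show "norm (norm (C_factor j - 1)) \<le> (1 / 2) ^ j" if "j \<ge> 0" for j
      using two_power_two_power_ge[of j] by (simp add: C_factor_eq power_divide field_simps)
  qed
  then show ?thesis
    by (intro abs_convergent_prod_imp_convergent_prod summable_imp_abs_convergent_prod)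
qed

lemma C_partial_tendsto: "C_partial \<longlonglongrightarrow> C_const"
proof -
  have "(\<lambda>n. \<Prod>i\<le>n. C_factor i) \<longlonglongrightarrow> C_const"
    using convergent_prod_LIMSEQ[OF convergent_prod_C_factor] by (simp add: C_const_def)
  then have "(\<lambda>n. C_partial (Suc n)) \<longlonglongrightarrow> C_const"
    by (simp only: C_partial_def lessThan_Suc_atMost)
  then show ?thesis by (rule LIMSEQ_imp_Suc)
qed

text \<open>With $x = 2^{1-2^k}$ the next factor is $1 + x^2/2$, and $(1+x)(1+x^2) \le 1 + 2x$ for
  $x \le 1/2$, so this majorant of the partial products decreases.\<close>

lemma C_majorant_antimono:
  assumes "1 \<le> k" "k \<le> k'"
  shows "C_partial k' * (1 + 4 / 2 ^ 2 ^ k') \<le> C_partial k * (1 + 4 / 2 ^ 2 ^ k)"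
  using assms(2)
proof (induction rule: dec_induct)
  case (step m)
  define x :: real where "x = 2 / 2 ^ 2 ^ m"
  \<comment> \<open>This is where \<open>1 \<le> k\<close> enters: 2^(2^m) is at least 4 from
    \<open>m\<close> = 1 on, which gives \<open>x\<close> at most 1/2.\<close>
  have "(2::real) ^ 2 \<le> 2 ^ 2 ^ m"
    using assms(1) step.hyps self_le_power[of 2 m] by (intro power_increasing) auto
  then have x: "0 \<le> x" "x \<le> 1 / 2" by (auto simp: x_def field_simps)
  have sq: "4 / 2 ^ 2 ^ Suc m = x ^ 2" by (simp add: x_def power_divide power_add mult_2 power2_eq_square)
  \<comment> \<open>Together these bound x^2 + x^3 by x, which is the claim about (1 + x)(1 + x^2)
    after expansion.\<close>
  have "x * x \<le> x * (1 / 2)" "x * (x * x) \<le> x * (1 / 2)"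
    using x mult_left_le[of x x] by (intro mult_left_mono; simp)+
  then have "(1 + x) * (1 + x ^ 2) \<le> 1 + 2 * x"
    by (simp add: algebra_simps power2_eq_square)
  then have "C_partial m * ((1 + x) * (1 + x ^ 2)) \<le> C_partial m * (1 + 2 * x)"
    using C_partial_pos[of m] by (intro mult_left_mono) auto
  also have "1 + 2 * x = 1 + 4 / 2 ^ 2 ^ m" by (simp add: x_def)
  also note step.IH
  also have "C_partial m * ((1 + x) * (1 + x ^ 2)) = C_partial (Suc m) * (1 + 4 / 2 ^ 2 ^ Suc m)"
    unfolding sq by (simp add: C_factor_eq x_def)
  finally show ?case .
qed simp

text \<open>Increasing partial products and the decreasing majorant, both evaluated at 5, enclose
  the limit. They differ only by the factor 1 + 2^-30, far less than half a unit of the fifth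
  decimal.\<close>

lemma C_const_approx: "\<bar>C_const - 3.40147\<bar> \<le> 0.000005"
proof -
  have P5: "C_partial 5 = 2 * (1 + 1/2) * (1 + 1/8) * (1 + 1/128) * (1 + 1/32768)"
    by (simp add: eval_nat_numeral C_factor_eq)
  have "3.401465 \<le> C_const"
  proof (rule LIMSEQ_le_const[OF C_partial_tendsto], intro exI allI impI)
    fix n :: nat assume "5 \<le> n"
    then have "C_partial 5 \<le> C_partial n" by (rule C_partial_mono)
    then show "3.401465 \<le> C_partial n" unfolding P5 by simp
  qed
  moreover have "C_const \<le> 3.401475"
  proof (rule LIMSEQ_le_const2[OF C_partial_tendsto], intro exI allI impI)
    fix n :: nat assume "5 \<le> n"
    then have "C_partial n * (1 + 4 / 2 ^ 2 ^ n) \<le> C_partial 5 * (1 + 4 / 2 ^ 2 ^ 5)"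
      by (intro C_majorant_antimono) auto
    moreover have "C_partial n * 1 \<le> C_partial n * (1 + 4 / 2 ^ 2 ^ n)"
      using C_partial_pos[of n] by (intro mult_left_mono) auto
    ultimately show "C_partial n \<le> 3.401475" unfolding P5 by simp
  qed
  ultimately show ?thesis unfolding abs_le_iff by simp
qed

section \<open>Growth of $D_z$\<close>

lemma hi_plus_lo: "hi n + lo n = n"
  by (simp add: hi_def lo_def)

lemma lo_le_hi: "lo n \<le> hi n"
  and hi_le_Suc_lo: "hi n \<le> Suc (lo n)"
  by (simp_all add: hi_def lo_def)

lemma Dz_rec: "2 \<le> n \<Longrightarrow> Dz n = 2 ^ (hi n - 1) * Dz (lo n) + Dz (hi n)"
  by (subst Dz.simps) simp

lemma Dz_0 [simp]: "Dz 0 = 0" and Dz_1 [simp]: "Dz (Suc 0) = 1"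
  by (simp_all add: Dz.simps)

lemma Dz_2: "Dz 2 = 2" and Dz_3: "Dz 3 = 4" and Dz_4: "Dz 4 = 6" and Dz_5: "Dz 5 = 12"
proof -
  show 2: "Dz 2 = 2" by (simp add: Dz_rec hi_def lo_def)
  show 3: "Dz 3 = 4" by (simp add: Dz_rec[of 3] hi_def lo_def 2)
  show "Dz 4 = 6" by (simp add: Dz_rec[of 4] hi_def lo_def 2)
  show "Dz 5 = 12" by (simp add: Dz_rec[of 5] hi_def lo_def 2 3)
qed

text \<open>The factor $1 - 2/n$ strengthens the induction hypothesis: halving the argument frees
  $2^n/n$, which pays for the second summand of the recursion.\<close>

lemma Dz_le_aux: "3 \<le> n \<Longrightarrow> real (Dz n) * (real n + 1) \<le> 6 * (1 - 2 / real n) * 2 ^ n"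
proof (induction n rule: less_induct)
  case (less n)
  \<comment> \<open>Both halves are at least 3 only from \<open>n\<close> = 6 on, hence three base
    cases. The constant 6 makes the bound an equality at \<open>n\<close> = 3.\<close>
  consider "n = 3" | "n = 4" | "n = 5" | "6 \<le> n" using less.prems by linarith
  then show ?case
  proof cases
    case 4
    define h l where "h = hi n" and "l = lo n"
    have n: "n = h + l" "l \<le> h" "h \<le> Suc l" "3 \<le> l"
      using 4 hi_plus_lo[of n] lo_le_hi[of n] hi_le_Suc_lo[of n] by (auto simp: h_def l_def lo_def)
    have IHl: "real (Dz l) * (real l + 1) \<le> 6 * (1 - 2 / real l) * 2 ^ l"
      using n by (intro less.IH) auto
    have "real (Dz h) * (real h + 1) \<le> 6 * (1 - 2 / real h) * 2 ^ h"
      using n by (intro less.IH) auto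
    also have "\<dots> \<le> 6 * 1 * 2 ^ h"
      using n by (intro mult_right_mono mult_left_mono) auto
    finally have IHh: "real (Dz h) * (real h + 1) \<le> 6 * 2 ^ h" by simp
    have "real (Dz n) = 2 ^ (h - 1) * real (Dz l) + real (Dz h)"
      using 4 by (simp add: Dz_rec h_def l_def)
    also have "(2::real) ^ (h - 1) = 2 ^ h / 2"
      using n by (cases h) auto
    finally have Dn: "real (Dz n) = 2 ^ h / 2 * real (Dz l) + real (Dz h)" .
    have "real (Dz n) * (real n + 1)
        = 2 ^ h / 2 * real (Dz l) * (real n + 1) + real (Dz h) * (real n + 1)"
      by (simp add: Dn algebra_simps)
    \<comment> \<open>The weight \<open>n\<close> + 1 suits odd \<open>n\<close>: there
      \<open>n\<close> + 1 = 2 (\<open>l\<close> + 1) exactly, so the dominant summand loses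
      nothing, and the 2 cancels the 1/2 from \<open>2 ^ (h - 1)\<close>.\<close>
    also have "\<dots> \<le> 2 ^ h / 2 * real (Dz l) * (2 * (real l + 1)) + real (Dz h) * (2 * (real h + 1))"
      using n by (intro add_mono mult_left_mono) auto
    also have "\<dots> = 2 ^ h * (real (Dz l) * (real l + 1)) + 2 * (real (Dz h) * (real h + 1))"
      by (simp add: algebra_simps)
    also have "\<dots> \<le> 2 ^ h * (6 * (1 - 2 / real l) * 2 ^ l) + 2 * (6 * 2 ^ h)"
      using IHl IHh by (intro add_mono mult_left_mono) auto
    also have "\<dots> = 6 * 2 ^ h * ((1 - 2 / real l) * 2 ^ l + 2)"
      by (simp add: algebra_simps)
    \<comment> \<open>Passing from 2/\<open>l\<close> to 2/\<open>n\<close> gains at least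
      1/\<open>l\<close>, as \<open>n\<close> is at least 2\<open>l\<close>. Since 2^l / l is at
      least 2, this absorbs the 2 left over from \<open>Dz h\<close>.\<close>
    also have "\<dots> \<le> 6 * 2 ^ h * ((1 - 2 / real n) * 2 ^ l)"
    proof (intro mult_left_mono)
      have "2 * real l \<le> 2 ^ l"
      proof -
        have "2 * l \<le> 2 ^ l" using n(4) by (induction rule: dec_induct) auto
        then have "real (2 * l) \<le> real (2 ^ l)" by (rule of_nat_mono)
        then show ?thesis by simp
      qed
      then have "2 \<le> 1 / real l * 2 ^ l" using n by (simp add: field_simps)
      also have "\<dots> \<le> (2 / real l - 2 / real n) * 2 ^ l"
      proof (rule mult_right_mono)
        have "2 / real n \<le> 2 / (2 * real l)" using n by (intro divide_left_mono) auto
        moreover have "2 / real l = 2 * (1 / real l)" "2 / (2 * real l) = 1 / real l" by simp_all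
        ultimately show "1 / real l \<le> 2 / real l - 2 / real n" by linarith
      qed simp
      finally show "(1 - 2 / real l) * 2 ^ l + 2 \<le> (1 - 2 / real n) * 2 ^ l"
        by (simp add: algebra_simps)
    qed simp
    also have "\<dots> = 6 * (1 - 2 / real n) * 2 ^ n" by (simp add: n(1) power_add)
    finally show ?thesis .
  qed (simp_all add: Dz_3 Dz_4 Dz_5)
qed

lemma Dz_le: "real (Dz n) * (real n + 1) \<le> 6 * 2 ^ n"
proof (cases "3 \<le> n")
  case True
  have "real (Dz n) * (real n + 1) \<le> 6 * (1 - 2 / real n) * 2 ^ n" by (rule Dz_le_aux[OF True])
  also have "\<dots> \<le> 6 * 1 * 2 ^ n" using True by (intro mult_right_mono mult_left_mono) auto
  finally show ?thesis by simp
next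
  case False
  then consider "n = 0" | "n = 1" | "n = 2" by linarith
  then show ?thesis by cases (auto simp: Dz_2)
qed

section \<open>Exact values of D_z at 2^k and 2^k - 1\<close>

lemma hi_two_power: "hi (2 ^ Suc k) = 2 ^ k" "hi (2 ^ Suc k - 1) = 2 ^ k"
  and lo_two_power: "lo (2 ^ Suc k) = 2 ^ k" "lo (2 ^ Suc k - 1) = 2 ^ k - 1"
proof -
  have "(1::nat) \<le> 2 ^ k" by simp
  then show "hi (2 ^ Suc k) = 2 ^ k" "hi (2 ^ Suc k - 1) = 2 ^ k"
    "lo (2 ^ Suc k) = 2 ^ k" "lo (2 ^ Suc k - 1) = 2 ^ k - 1"
    unfolding hi_def lo_def power_Suc by presburger+
qed

lemma real_two_power_two_power_minus_1: "(2::real) ^ (2 ^ k - Suc 0) = 2 ^ 2 ^ k / 2"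
  by (simp add: power_diff)

lemma real_two_power_two_power_Suc: "(2::real) ^ 2 ^ Suc k = 2 ^ 2 ^ k * 2 ^ 2 ^ k"
  by (simp add: mult_2 power_add)

lemma Dz_two_power_Suc: "real (Dz (2 ^ Suc k)) = (2 ^ 2 ^ k / 2 + 1) * real (Dz (2 ^ k))"
proof -
  have "Dz (2 ^ Suc k) = 2 ^ (2 ^ k - 1) * Dz (2 ^ k) + Dz (2 ^ k)"
    by (subst Dz_rec) (simp_all only: hi_two_power lo_two_power, simp)
  then show ?thesis
    by (simp add: real_two_power_two_power_minus_1 distrib_right)
qed

text \<open>The high half 2^k is the same as for 2^(k+1), so subtracting the two recursions cancels
  \<open>Dz (2 ^ k)\<close>.\<close>

lemma Dz_two_power_Suc_minus_1:
  "real (Dz (2 ^ Suc k - 1)) = 2 ^ 2 ^ k / 2 * real (Dz (2 ^ k - 1)) + real (Dz (2 ^ k))"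
\<comment> \<open>For \<open>k\<close> = 0 the argument is 1, outside the recursion; the identity
  then rests on the dummy \<open>Dz 0 = 0\<close>.\<close>
proof (cases "k = 0")
  case False
  then have "(2::nat) ^ 2 \<le> 2 ^ Suc k" by (intro power_increasing) auto
  then have "2 \<le> (2::nat) ^ Suc k - 1" by simp
  then have "Dz (2 ^ Suc k - 1) = 2 ^ (2 ^ k - 1) * Dz (2 ^ k - 1) + Dz (2 ^ k)"
    by (simp only: Dz_rec[of "2 ^ Suc k - 1"] hi_two_power lo_two_power)
  then show ?thesis
    by (simp add: real_two_power_two_power_minus_1)
qed simp

text \<open>Each doubling multiplies D_z by 2^(2^k)/2 + 1, which is 2^(2^k)/2 times
  \<open>C_factor k\<close>. The powers of two telescope and the remaining factors form
  \<open>C_partial k\<close>.\<close>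

lemma Dz_two_power: "real (Dz (2 ^ k)) * (2 * 2 ^ k) = 2 ^ 2 ^ k * C_partial k"
proof (induction k)
  case (Suc k)
  have "real (Dz (2 ^ Suc k)) * (2 * 2 ^ Suc k)
      = (2 ^ 2 ^ k / 2 + 1) * 2 * (real (Dz (2 ^ k)) * (2 * 2 ^ k))"
    unfolding Dz_two_power_Suc by simp
  also have "\<dots> = (2 ^ 2 ^ k / 2 + 1) * 2 * (2 ^ 2 ^ k * C_partial k)"
    by (simp only: Suc.IH)
  also have "\<dots> = 2 ^ 2 ^ Suc k * C_partial (Suc k)"
    unfolding real_two_power_two_power_Suc C_partial_Suc C_factor_eq by (simp add: field_simps)
  finally show ?case .
qed simp

text \<open>The base case uses the dummy value of \<^const>\<open>Dz\<close> at 0.\<close>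

lemma Dz_two_power_minus_1_gap:
  "(real (Dz (2 ^ k)) - real (Dz (2 ^ k - 1))) * (2 * 2 ^ k) = 2 ^ 2 ^ k"
proof (induction k)
  case (Suc k)
  have "(real (Dz (2 ^ Suc k)) - real (Dz (2 ^ Suc k - 1))) * (2 * 2 ^ Suc k)
      = 2 ^ 2 ^ k * ((real (Dz (2 ^ k)) - real (Dz (2 ^ k - 1))) * (2 * 2 ^ k))"
    unfolding Dz_two_power_Suc Dz_two_power_Suc_minus_1 by (simp add: algebra_simps)
  also have "\<dots> = 2 ^ 2 ^ k * 2 ^ 2 ^ k" by (simp only: Suc.IH)
  finally show ?case unfolding real_two_power_two_power_Suc .
qed simp

text \<open>The gap has the closed form of \<open>Dz (2 ^ k)\<close> with 1 in place of
  \<open>C_partial k\<close>; this is the source of C - 1 in the second limit.\<close>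

lemma Dz_two_power_minus_1:
  "real (Dz (2 ^ k - 1)) * (2 * 2 ^ k) = 2 ^ 2 ^ k * (C_partial k - 1)"
  using Dz_two_power_minus_1_gap[of k] Dz_two_power[of k] by (simp add: algebra_simps)

section \<open>Routing costs\<close>

text \<open>Only coordinate 0 exists at width 1, so no jump occurs.\<close>

lemma jump_density_width_1:
  assumes "closed_gray_code 1 xs"
  shows "jump_density 1 xs = 0"
proof -
  have "xs ! t = 0" if "t < 2" for t
  proof -
    have "xs ! t \<in> set xs" "set xs \<subseteq> {..<1}"
      using assms that by (auto simp: closed_gray_code_def)
    then show ?thesis by auto
  qed
  then show ?thesis by (simp add: jump_density_def cyc_dist_def)
qed

text \<open>The two circuits differ only in the kinds of their blocks, which the row cost ignores.
  One row count therefore serves for both.\<close>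

lemma row_route_gpf: "row_route \<mu> r (gpf G n) = row_route \<mu> r (gpf_star G n)"
proof (induction n arbitrary: r rule: less_induct)
  case (less n)
  show ?case
  proof (cases "n \<le> 1")
    case False
    then have "hi n < n" by (simp add: hi_def)
    with False less.IH[of "hi n"] show ?thesis
      by (simp add: gpf.simps[of G n] gpf_star.simps[of G n] row_block_cost_def block_density_def
          map_replicate_const)
  qed (simp add: gpf.simps gpf_star.simps)
qed

lemma S_GPF_1L_eq_star: "S_GPF_1L = S_GPF_star_1L"
  by (intro ext) (simp add: S_GPF_1L_def S_GPF_star_1L_def row_route_gpf)

section \<open>Recurrences and initial values\<close>

context
  fixes \<mu> :: real and G :: "nat \<Rightarrow> nat list"
  assumes gray: "\<And>w. 1 \<le> w \<Longrightarrow> closed_gray_code w (G w)"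
begin

text \<open>Two qubits do carry a mixing block, but its high width is 1 and it is charged the
  density 0; fewer qubits carry none.\<close>

lemma S_GPF_star_1L_small: "n \<le> 2 \<Longrightarrow> S_GPF_star_1L \<mu> G n r = 0"
  and S_GPF_2L_small: "n \<le> 2 \<Longrightarrow> S_GPF_2L \<mu> G n = 0"
proof -
  have local: "gpf_star G m = Local" "gpf G m = Local" if "m \<le> 1" for m
    using that by (simp_all add: gpf.simps gpf_star.simps)
  have density: "jump_density 1 (G 1) = 0"
    by (rule jump_density_width_1[OF gray]) simp
  have halves: "hi 2 = 1" "lo 2 = 1" by (simp_all add: hi_def lo_def)
  show "S_GPF_star_1L \<mu> G n r = 0" if "n \<le> 2"
  proof (cases "n = 2")
    case True
    with density show ?thesis
      by (simp add: S_GPF_star_1L_def gpf_star.simps[of G 2] halves local row_block_cost_def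
          block_density_def sum_list_replicate)
  qed (use that local in \<open>simp add: S_GPF_star_1L_def\<close>)
  show "S_GPF_2L \<mu> G n = 0" if "n \<le> 2"
  proof (cases "n = 2")
    case True
    with density show ?thesis
      by (simp add: S_GPF_2L_def gpf.simps[of G 2] halves local two_row_block_cost_def
          sum_list_replicate)
  qed (use that local in \<open>simp add: S_GPF_2L_def\<close>)
qed

lemma S_GPF_star_1L_rec:
  assumes "3 \<le> n"
  shows "S_GPF_star_1L \<mu> G n r =
     3 * (2 * real (hi n) - 1) * \<mu> * 2 ^ r * 2 ^ hi n * real (Dz (lo n))
     + S_GPF_star_1L \<mu> G (hi n) (r + 1) + S_GPF_star_1L \<mu> G (lo n) (r + 1)"
proof -
  \<comment> \<open>The high width is now at least 2, so the block is charged \<open>\<mu>\<close>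
    rather than the exceptional zero.\<close>
  have "hi n \<noteq> 1" using assms by (simp add: hi_def)
  with assms show ?thesis
    by (simp add: S_GPF_star_1L_def gpf_star.simps[of G n] row_block_cost_def block_density_def
        sum_list_replicate)
qed

lemma S_GPF_2L_rec:
  assumes "3 \<le> n"
  shows "S_GPF_2L \<mu> G n =
     3 * (real (hi n) - 1) * \<mu> * 2 ^ hi n * real (Dz (lo n))
     + S_GPF_star_1L \<mu> G (hi n) 0 + S_GPF_star_1L \<mu> G (lo n) 0"
proof -
  have "hi n \<noteq> 1" using assms by (simp add: hi_def)
  with assms show ?thesis
    by (simp add: S_GPF_star_1L_def S_GPF_2L_def gpf.simps[of G n] two_row_block_cost_def
        block_density_def sum_list_replicate row_route_gpf)
qed

section \<open>Size of the routing costs\<close>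

context
  assumes mu_pos: "0 < \<mu>"
begin

text \<open>Half of 72 pays for the mixing blocks, 36 = 6 * 6 coming from \<open>Dz_le\<close>. The
  other half pays for the recursive calls: their level doubles 72 to 144, but their widths are only
  about half of \<open>n\<close>.\<close>

lemma S_GPF_star_1L_bounds:
  "0 \<le> S_GPF_star_1L \<mu> G n r \<and> S_GPF_star_1L \<mu> G n r \<le> 72 * \<mu> * 2 ^ r * 2 ^ n"
proof (induction n arbitrary: r rule: less_induct)
  case (less n)
  show ?case
  proof (cases "3 \<le> n")
    case False
    then show ?thesis using mu_pos by (simp add: S_GPF_star_1L_small)
  next
    case True
    define h l where "h = hi n" and "l = lo n"
    define a where "a = \<mu> * 2 ^ r"
    have a: "0 < a" using mu_pos by (simp add: a_def)
    have n: "n = h + l" "l \<le> h" "h \<le> Suc l" "1 \<le> l"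
      using True hi_plus_lo[of n] lo_le_hi[of n] hi_le_Suc_lo[of n]
      by (auto simp: h_def l_def lo_def)
    let ?S = "\<lambda>m. S_GPF_star_1L \<mu> G m (r + 1)"
    have IH: "0 \<le> ?S h" "?S h \<le> 144 * a * 2 ^ h" "0 \<le> ?S l" "?S l \<le> 144 * a * 2 ^ l"
      using less.IH[of h "r + 1"] less.IH[of l "r + 1"] n by (auto simp: a_def)
    define M where "M = 3 * (2 * real h - 1) * a * 2 ^ h * real (Dz l)"
    have rec: "S_GPF_star_1L \<mu> G n r = M + ?S h + ?S l"
      using S_GPF_star_1L_rec[OF True, of r] by (simp add: M_def h_def l_def a_def)
    have "0 \<le> M" using n a by (auto simp: M_def intro!: mult_nonneg_nonneg)
    have "M \<le> 3 * (2 * (real l + 1)) * a * 2 ^ h * real (Dz l)"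
      unfolding M_def using n a by (intro mult_right_mono mult_left_mono) auto
    also have "\<dots> = 6 * a * 2 ^ h * (real (Dz l) * (real l + 1))" by simp
    also have "\<dots> \<le> 6 * a * 2 ^ h * (6 * 2 ^ l)"
      using a by (intro mult_left_mono Dz_le) auto
    finally have M: "M \<le> 36 * a * 2 ^ n" by (simp add: n(1) power_add)
    have "?S h + ?S l \<le> 36 * a * 2 ^ n"
    proof -
      \<comment> \<open>From \<open>l\<close> = 3 on, 144 (2^h + 2^l) is at most 36 * 8 * 2^h, hence
        at most 36 * 2^n. For \<open>l\<close> = 2 only the high half costs anything, and 144 * 2^h
        = 36 * 2^n; for \<open>l\<close> = 1 neither half does.\<close>
      consider "l = 1" | "l = 2" | "3 \<le> l" using n(4) by linarith
      then show ?thesis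
      proof cases
        case 1
        with n have "h \<le> 2" by simp
        with 1 a show ?thesis by (simp add: S_GPF_star_1L_small)
      next
        case 2
        with IH(2) show ?thesis by (simp add: S_GPF_star_1L_small n(1) power_add)
      next
        case 3
        then have "(2::real) ^ 3 \<le> 2 ^ l" by (intro power_increasing) auto
        then have "36 * a * 2 ^ h * 8 \<le> 36 * a * 2 ^ h * 2 ^ l"
          using a by (intro mult_left_mono) auto
        moreover have "144 * a * 2 ^ l \<le> 144 * a * 2 ^ h"
          using a n by (intro mult_left_mono power_increasing) auto
        moreover have "36 * a * 2 ^ n = 36 * a * 2 ^ h * 2 ^ l" by (simp add: n(1) power_add)
        ultimately show ?thesis using IH by linarith
      qed
    qed
    then show ?thesis
      using rec M IH \<open>0 \<le> M\<close> by (simp add: a_def)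
  qed
qed

text \<open>Both rows cost O(2^(hi n)), and 2^(hi n) = 2^n / 2^(lo n). This is the relative error
  that vanishes as the low half grows.\<close>

lemma S_GPF_star_1L_rest_le:
  "S_GPF_star_1L \<mu> G (hi n) 0 + S_GPF_star_1L \<mu> G (lo n) 0 \<le> 144 * \<mu> / 2 ^ lo n * 2 ^ n"
proof -
  have "S_GPF_star_1L \<mu> G (hi n) 0 \<le> 72 * \<mu> * 2 ^ hi n"
    "S_GPF_star_1L \<mu> G (lo n) 0 \<le> 72 * \<mu> * 2 ^ lo n"
    using S_GPF_star_1L_bounds[of "hi n" 0] S_GPF_star_1L_bounds[of "lo n" 0] by auto
  moreover have "72 * \<mu> * 2 ^ lo n \<le> 72 * \<mu> * 2 ^ hi n"
    using mu_pos lo_le_hi by (intro mult_left_mono power_increasing) auto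
  moreover have "(2::real) ^ n = 2 ^ hi n * 2 ^ lo n"
    by (simp add: hi_plus_lo flip: power_add)
  ultimately show ?thesis by simp
qed

text \<open>The normalized cost of the top-level two-row blocks, which alone determines the
  limits.\<close>

definition main_term :: "nat \<Rightarrow> real" where
  "main_term n = 3 * (real (hi n) - 1) * \<mu> * 2 ^ hi n * real (Dz (lo n)) / 2 ^ n"

lemma S_GPF_2L_near_main_term:
  assumes "3 \<le> n"
  shows "\<bar>S_GPF_2L \<mu> G n / 2 ^ n - main_term n\<bar> \<le> 144 * \<mu> / 2 ^ lo n"
proof -
  let ?R = "S_GPF_star_1L \<mu> G (hi n) 0 + S_GPF_star_1L \<mu> G (lo n) 0"
  have "S_GPF_2L \<mu> G n / 2 ^ n - main_term n = ?R / 2 ^ n"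
    by (simp add: S_GPF_2L_rec[OF assms] main_term_def add_divide_distrib)
  moreover have "0 \<le> ?R"
    using S_GPF_star_1L_bounds by (meson add_nonneg_nonneg)
  ultimately show ?thesis
    using S_GPF_star_1L_rest_le[of n] by (simp add: pos_divide_le_eq)
qed

lemma main_term_bounds:
  assumes "3 \<le> n"
  shows "0 \<le> main_term n" "main_term n \<le> 18 * \<mu>"
proof -
  have "1 \<le> hi n" using assms by (simp add: hi_def)
  then show "0 \<le> main_term n" using mu_pos by (simp add: main_term_def)
  have "3 * (real (hi n) - 1) * \<mu> * 2 ^ hi n * real (Dz (lo n))
      \<le> 3 * (real (lo n) + 1) * \<mu> * 2 ^ hi n * real (Dz (lo n))"
    using mu_pos hi_le_Suc_lo[of n] by (intro mult_right_mono mult_left_mono) auto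
  also have "\<dots> = 3 * \<mu> * 2 ^ hi n * (real (Dz (lo n)) * (real (lo n) + 1))" by simp
  also have "\<dots> \<le> 3 * \<mu> * 2 ^ hi n * (6 * 2 ^ lo n)"
    using mu_pos by (intro mult_left_mono Dz_le) auto
  also have "\<dots> = 18 * \<mu> * 2 ^ n" by (simp add: hi_plus_lo flip: power_add)
  finally show "main_term n \<le> 18 * \<mu>" by (simp add: main_term_def pos_divide_le_eq)
qed

lemma Bseq_S_GPF_2L: "Bseq (\<lambda>n. S_GPF_2L \<mu> G n / 2 ^ n)"
proof (rule BseqI')
  fix n
  \<comment> \<open>162 = 18 + 144: the bound on \<open>main_term\<close> plus the error at its
    largest.\<close>
  show "norm (S_GPF_2L \<mu> G n / 2 ^ n) \<le> 162 * \<mu>"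
  proof (cases "3 \<le> n")
    case True
    have "144 * \<mu> / 2 ^ lo n \<le> 144 * \<mu> / 1"
      using mu_pos by (intro divide_left_mono) auto
    then show ?thesis
      using S_GPF_2L_near_main_term[OF True] main_term_bounds[OF True] by simp
  next
    case False
    then show ?thesis using mu_pos by (simp add: S_GPF_2L_small)
  qed
qed

section \<open>Limits along the two subsequences and the oscillation\<close>

lemma S_GPF_2L_tendsto:
  assumes N: "filterlim (\<lambda>k. lo (N k)) at_top sequentially"
    and main: "(\<lambda>k. main_term (N k)) \<longlonglongrightarrow> L"
  shows "(\<lambda>k. S_GPF_2L \<mu> G (N k) / 2 ^ N k) \<longlonglongrightarrow> L"
proof -
  have "((\<lambda>m. 144 * \<mu> * (1 / 2) ^ m) \<longlongrightarrow> 144 * \<mu> * 0) at_top"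
    by (intro tendsto_intros LIMSEQ_power_zero) auto
  then have "(\<lambda>k. 144 * \<mu> * (1 / 2) ^ lo (N k)) \<longlonglongrightarrow> 144 * \<mu> * 0"
    using N by (rule filterlim_compose)
  then have 0: "(\<lambda>k. 144 * \<mu> / 2 ^ lo (N k)) \<longlonglongrightarrow> 0"
    by (simp add: power_divide)
  have "\<forall>\<^sub>F k in sequentially. 2 \<le> lo (N k)"
    using N by (simp add: filterlim_at_top)
  then have "\<forall>\<^sub>F k in sequentially.
      norm (S_GPF_2L \<mu> G (N k) / 2 ^ N k - main_term (N k)) \<le> 144 * \<mu> / 2 ^ lo (N k)"
  proof eventually_elim
    case (elim k)
    then have "3 \<le> N k" by (simp add: lo_def)
    from S_GPF_2L_near_main_term[OF this] show ?case by simp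
  qed
  then have "(\<lambda>k. S_GPF_2L \<mu> G (N k) / 2 ^ N k - main_term (N k)) \<longlonglongrightarrow> 0"
    using 0 by (rule Lim_null_comparison)
  from tendsto_add[OF this main] show ?thesis by simp
qed

lemma one_minus_inverse_two_power_tendsto: "(\<lambda>k. 1 - (1 / 2 :: real) ^ k) \<longlonglongrightarrow> 1 - 0"
  by (intro tendsto_intros LIMSEQ_power_zero) auto

lemma filterlim_two_power: "filterlim (\<lambda>k. 2 ^ k :: nat) at_top sequentially"
  by (rule filterlim_at_top_mono[OF filterlim_ident]) (simp add: less_imp_le)

lemma S_GPF_2L_two_power_tendsto:
  "(\<lambda>k. S_GPF_2L \<mu> G (2 ^ k) / 2 ^ 2 ^ k) \<longlonglongrightarrow> 3 / 2 * \<mu> * C_const"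
proof -
  \<comment> \<open>The factor 1 - (1/2)^k is (2^k - 1) / 2^k: the numerator is the cost factor
    \<open>hi n - 1\<close>, the denominator comes from D_z.\<close>
  have main: "main_term (2 ^ Suc k) = 3 / 2 * \<mu> * (1 - (1 / 2) ^ k) * C_partial k" for k
  proof -
    have D: "real (Dz (2 ^ k)) = 2 ^ 2 ^ k * C_partial k / (2 * 2 ^ k)"
      using Dz_two_power[of k] by (simp add: field_simps)
    show ?thesis
      unfolding main_term_def hi_two_power lo_two_power D real_two_power_two_power_Suc
      by (simp add: field_simps)
  qed
  have "(\<lambda>k. 3 / 2 * \<mu> * (1 - (1 / 2) ^ k) * C_partial k) \<longlonglongrightarrow> 3 / 2 * \<mu> * (1 - 0) * C_const"
    by (intro tendsto_mult tendsto_const one_minus_inverse_two_power_tendsto C_partial_tendsto)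
  then have "(\<lambda>k. S_GPF_2L \<mu> G (2 ^ Suc k) / 2 ^ 2 ^ Suc k) \<longlonglongrightarrow> 3 / 2 * \<mu> * C_const"
    by (intro S_GPF_2L_tendsto) (simp_all add: main lo_two_power filterlim_two_power del: power_Suc)
  then show ?thesis by (rule LIMSEQ_imp_Suc)
qed

lemma S_GPF_2L_two_power_minus_1_tendsto:
  "(\<lambda>k. S_GPF_2L \<mu> G (2 ^ k - 1) / 2 ^ (2 ^ k - 1)) \<longlonglongrightarrow> 3 / 2 * \<mu> * (2 * (C_const - 1))"
proof -
  \<comment> \<open>The extra factor 2 arises because the normalizing power 2^n has exponent one
    less than 2^(k+1).\<close>
  have main: "main_term (2 ^ Suc k - 1) = 3 / 2 * \<mu> * (1 - (1 / 2) ^ k) * (2 * (C_partial k - 1))"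
    for k
  proof -
    have D: "real (Dz (2 ^ k - 1)) = 2 ^ 2 ^ k * (C_partial k - 1) / (2 * 2 ^ k)"
      using Dz_two_power_minus_1[of k] by (simp add: field_simps)
    have "(2::real) ^ (2 ^ Suc k - 1) = 2 ^ 2 ^ k * 2 ^ 2 ^ k / 2"
      using real_two_power_two_power_minus_1[of "Suc k"]
      unfolding real_two_power_two_power_Suc by simp
    then show ?thesis
      unfolding main_term_def hi_two_power lo_two_power D by (simp only:) (simp add: field_simps)
  qed
  have "filterlim (\<lambda>k. lo (2 ^ Suc k - 1)) at_top sequentially"
    unfolding lo_two_power
  proof (rule filterlim_at_top_mono[OF filterlim_ident], intro always_eventually allI)
    show "k \<le> 2 ^ k - 1" for k :: nat
      using less_exp[of k] by linarith
  qed
  moreover have "(\<lambda>k. main_term (2 ^ Suc k - 1))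
      \<longlonglongrightarrow> 3 / 2 * \<mu> * (1 - 0) * (2 * (C_const - 1))"
    unfolding main
    by (intro tendsto_mult tendsto_diff tendsto_const one_minus_inverse_two_power_tendsto
        C_partial_tendsto)
  ultimately have "(\<lambda>k. S_GPF_2L \<mu> G (2 ^ Suc k - 1) / 2 ^ (2 ^ Suc k - 1))
      \<longlonglongrightarrow> 3 / 2 * \<mu> * (2 * (C_const - 1))"
    unfolding diff_zero mult_1_right by (rule S_GPF_2L_tendsto)
  then show ?thesis by (rule LIMSEQ_imp_Suc)
qed

text \<open>The limits at the two ends of a window satisfy C < 2 (C - 1) because C > 2; any two
  levels strictly between them work.\<close>

lemma sawtooth_oscillation_S_GPF_2L: "sawtooth_oscillation (\<lambda>n. S_GPF_2L \<mu> G n / 2 ^ n)"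
proof -
  let ?a = "\<lambda>n. S_GPF_2L \<mu> G n / 2 ^ n"
  have "3.4 < C_const" using C_const_approx unfolding abs_le_iff by simp
  then have lim: "3 / 2 * \<mu> * C_const < 3 / 2 * \<mu> * (2 * (C_const - 1))"
    using mu_pos by (intro mult_strict_left_mono) auto
  then obtain p where p: "3 / 2 * \<mu> * C_const < p" "p < 3 / 2 * \<mu> * (2 * (C_const - 1))"
    using dense by blast
  then obtain q where q: "p < q" "q < 3 / 2 * \<mu> * (2 * (C_const - 1))"
    using dense by blast
  have "\<forall>\<^sub>F k in sequentially. ?a (2 ^ k) < p"
    by (rule order_tendstoD(2)[OF S_GPF_2L_two_power_tendsto p(1)])
  moreover have "\<forall>\<^sub>F k in sequentially. q < ?a (2 ^ Suc k - 1)"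
    by (rule order_tendstoD(1)[OF LIMSEQ_Suc[OF S_GPF_2L_two_power_minus_1_tendsto] q(2)])
  ultimately have "\<forall>\<^sub>F k in sequentially. ?a (2 ^ k) \<le> p \<and> q \<le> ?a (2 ^ (k + 1) - 1)"
    by eventually_elim (simp add: less_imp_le)
  then show ?thesis
    unfolding sawtooth_oscillation_def using Bseq_S_GPF_2L q(1) by blast
qed

end

end

theorem theorem6:
  fixes \<mu> :: real and G :: "nat \<Rightarrow> nat list"
  assumes mu_pos: "0 < \<mu>"
    and gray: "\<And>w. 1 \<le> w \<Longrightarrow> closed_gray_code w (G w)"
  shows
    "convergent_prod C_factor \<and> \<bar>C_const - 3.40147\<bar> \<le> 0.000005 \<and>
     (\<forall>n\<ge>3. S_GPF_2L \<mu> G n =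
        3 * (real (hi n) - 1) * \<mu> * 2 ^ hi n * real (Dz (lo n))
        + S_GPF_1L \<mu> G (hi n) 0 + S_GPF_star_1L \<mu> G (lo n) 0) \<and>
     (\<forall>n\<ge>3. \<forall>r. S_GPF_1L \<mu> G n r =
        3 * (2 * real (hi n) - 1) * \<mu> * 2 ^ r * 2 ^ hi n * real (Dz (lo n))
        + S_GPF_1L \<mu> G (hi n) (r + 1) + S_GPF_star_1L \<mu> G (lo n) (r + 1)) \<and>
     (\<forall>n\<ge>3. \<forall>r. S_GPF_star_1L \<mu> G n r =
        3 * (2 * real (hi n) - 1) * \<mu> * 2 ^ r * 2 ^ hi n * real (Dz (lo n))
        + S_GPF_star_1L \<mu> G (hi n) (r + 1) + S_GPF_star_1L \<mu> G (lo n) (r + 1)) \<and>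
     (\<forall>n\<le>2. S_GPF_2L \<mu> G n = 0 \<and>
        (\<forall>r. S_GPF_1L \<mu> G n r = 0 \<and> S_GPF_star_1L \<mu> G n r = 0)) \<and>
     sawtooth_oscillation (\<lambda>n. S_GPF_2L \<mu> G n / 2 ^ n) \<and>
     (\<lambda>k. S_GPF_2L \<mu> G (2 ^ k) / 2 ^ (2 ^ k)) \<longlonglongrightarrow> 3 / 2 * \<mu> * C_const \<and>
     (\<lambda>k. S_GPF_2L \<mu> G (2 ^ k - 1) / 2 ^ (2 ^ k - 1)) \<longlonglongrightarrow> 3 / 2 * \<mu> * (2 * (C_const - 1)) \<and>
     (\<mu> = 1.06 \<longrightarrow>
        \<bar>3 / 2 * \<mu> * C_const - 5.41\<bar> \<le> 0.005 \<and>
        \<bar>3 / 2 * \<mu> * (2 * (C_const - 1)) - 7.64\<bar> \<le> 0.005)"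
proof (intro conjI allI impI)
  show "convergent_prod C_factor" by (rule convergent_prod_C_factor)
  show "\<bar>C_const - 3.40147\<bar> \<le> 0.000005" by (rule C_const_approx)
  show "sawtooth_oscillation (\<lambda>n. S_GPF_2L \<mu> G n / 2 ^ n)"
    by (rule sawtooth_oscillation_S_GPF_2L[OF gray mu_pos])
  show "(\<lambda>k. S_GPF_2L \<mu> G (2 ^ k) / 2 ^ (2 ^ k)) \<longlonglongrightarrow> 3 / 2 * \<mu> * C_const"
    by (rule S_GPF_2L_two_power_tendsto[OF gray mu_pos])
  show "(\<lambda>k. S_GPF_2L \<mu> G (2 ^ k - 1) / 2 ^ (2 ^ k - 1)) \<longlonglongrightarrow> 3 / 2 * \<mu> * (2 * (C_const - 1))"
    by (rule S_GPF_2L_two_power_minus_1_tendsto[OF gray mu_pos])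
  \<comment> \<open>With 3/2 * 1.06 = 1.59 this enclosure yields about 5.4083 and 7.6367.\<close>
  have C: "3.401465 \<le> C_const" "C_const \<le> 3.401475"
    using C_const_approx unfolding abs_le_iff by auto
  show "\<bar>3 / 2 * \<mu> * C_const - 5.41\<bar> \<le> 0.005"
    and "\<bar>3 / 2 * \<mu> * (2 * (C_const - 1)) - 7.64\<bar> \<le> 0.005" if "\<mu> = 1.06"
    using C unfolding that abs_le_iff by (simp_all add: algebra_simps)
\<comment> \<open>The recurrences and zero values remain; identifying the two row counts reduces the
  GPF clauses to those for the starred family.\<close>
qed (simp_all only: S_GPF_1L_eq_star S_GPF_star_1L_small[OF gray] S_GPF_2L_small[OF gray]
    S_GPF_star_1L_rec[OF gray] S_GPF_2L_rec[OF gray])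

end
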